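(* Let $\epsilon$ be a constant in $(0,1)$. Then there is a randomized algorithm which, given $M>0$ and a list of nonnegative numbers $a_1,\ldots,a_n$ in the range $[0,M]$, with probability at least $3/4$ computes a $(1+\epsilon)$-approximation for the sum of the list, i.e. a real number $s$ with $$\frac{\sum_{i=1}^n a_i}{1+\epsilon}\le s\le (1+\epsilon)\sum_{i=1}^n a_i ,$$ in time $O\!\left(\frac{M n\log\log n}{\sum_{i=1}^n a_i}\right)$, where the constant in $O(\cdot)$ depends only on $\epsilon$.
   Context: The algorithm is given $n$ and $M$ and has access to the list $L=(a_1,\ldots,a_n)$: in unit time it can draw an index uniformly at random from $\{1,\ldots,n\}$ (independently of earlier draws) and read the corresponding item, and it can also read the item at a chosen position in unit time. Elementary operations on numbers take unit time. The algorithm does not know $\sum_{i=1}^n a_i$ in advance. Logarithms are base 2, and the time bound is asymptotic, i.e. for all sufficiently large $n$. If $\sum_{i=1}^n a_i=0$, the time bound is read as $+\infty$ (no constraint on the time). *)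

theory Defs
  imports "HOL-Probability.Probability"
begin

text \<open>
  A probabilistic random access machine over the reals. A program is a finite instruction
  sequence, fixed independently of the input; real literals are allowed, as usual for real RAMs.
  The only operations on numbers are the four field operations and comparison (in particular there
  is no unit-cost rounding or logarithm), and every executed instruction costs one unit of time.
\<close>

datatype operand = Const real | Reg nat

datatype arith_op = Add | Sub | Mul | Div

datatype instr =
    Arith nat arith_op operand operand
  | Jump_less operand operand nat
  | Load nat operand
  | Store operand operand
  | Sample nat nat
  | Read nat operand
  | Halt operand

type_synonym memory = "nat \<Rightarrow> real"

text \<open>
  \<open>Running pc \<sigma> t\<close>: program counter, memory and elapsed time;
  \<open>Halted s t\<close>: output and total running time.
\<close>

datatype config = Running nat memory nat | Halted real nat

fun val :: "memory \<Rightarrow> operand \<Rightarrow> real" where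
  "val \<sigma> (Const c) = c"
| "val \<sigma> (Reg r) = \<sigma> r"

fun arith :: "arith_op \<Rightarrow> real \<Rightarrow> real \<Rightarrow> real" where
  "arith Add x y = x + y"
| "arith Sub x y = x - y"
| "arith Mul x y = x * y"
| "arith Div x y = x / y"

text \<open>Truncation is only a convention that makes addressing by real-valued operands total.\<close>

definition addr :: "real \<Rightarrow> nat" where
  "addr x = nat \<lfloor>x\<rfloor>"

text \<open>List positions are numbered from 1; reading outside the list yields 0.\<close>

definition item :: "real list \<Rightarrow> nat \<Rightarrow> real" where
  "item xs i = (if 1 \<le> i \<and> i \<le> length xs then xs ! (i - 1) else 0)"

text \<open>
  \<open>Sample r r'\<close> draws a fresh uniformly random position, puts it into register \<open>r\<close>, and puts the
  item at that position into register \<open>r'\<close>.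
\<close>

fun exec :: "real list \<Rightarrow> instr \<Rightarrow> nat \<Rightarrow> memory \<Rightarrow> nat \<Rightarrow> config pmf" where
  "exec xs (Arith r f x y) pc \<sigma> t =
     return_pmf (Running (Suc pc) (\<sigma>(r := arith f (val \<sigma> x) (val \<sigma> y))) (Suc t))"
| "exec xs (Jump_less x y l) pc \<sigma> t =
     return_pmf (Running (if val \<sigma> x < val \<sigma> y then l else Suc pc) \<sigma> (Suc t))"
| "exec xs (Load r x) pc \<sigma> t =
     return_pmf (Running (Suc pc) (\<sigma>(r := \<sigma> (addr (val \<sigma> x)))) (Suc t))"
| "exec xs (Store x y) pc \<sigma> t =
     return_pmf (Running (Suc pc) (\<sigma>(addr (val \<sigma> x) := val \<sigma> y)) (Suc t))"
| "exec xs (Sample r r') pc \<sigma> t =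
     map_pmf (\<lambda>i. Running (Suc pc) (\<sigma>(r := real i, r' := item xs i)) (Suc t))
       (pmf_of_set {1..length xs})"
| "exec xs (Read r x) pc \<sigma> t =
     return_pmf (Running (Suc pc) (\<sigma>(r := item xs (addr (val \<sigma> x)))) (Suc t))"
| "exec xs (Halt x) pc \<sigma> t = return_pmf (Halted (val \<sigma> x) (Suc t))"

text \<open>A machine whose program counter leaves the program is stuck and never halts.\<close>

fun step :: "instr list \<Rightarrow> real list \<Rightarrow> config \<Rightarrow> config pmf" where
  "step P xs (Halted s t) = return_pmf (Halted s t)"
| "step P xs (Running pc \<sigma> t) =
     (if pc < length P then exec xs (P ! pc) pc \<sigma> t else return_pmf (Running pc \<sigma> t))"

text \<open>
  Apart from access to the list, the input consists only of its length (register 0)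
  and of the upper bound on its items (register 1).
\<close>

definition init :: "real \<Rightarrow> real list \<Rightarrow> config" where
  "init M xs = Running 0 ((\<lambda>_. 0)(0 := real (length xs), 1 := M)) 0"

fun run :: "instr list \<Rightarrow> real \<Rightarrow> real list \<Rightarrow> nat \<Rightarrow> config pmf" where
  "run P M xs 0 = return_pmf (init M xs)"
| "run P M xs (Suc k) = bind_pmf (run P M xs k) (step P xs)"

text \<open>
  The probability that the machine halts with an output in \<open>A\<close> after at most \<open>B\<close> time units. Halted
  configurations are absorbing, so the probabilities below increase with \<open>k\<close> and the supremum is
  the probability of this event over complete (unbounded) executions.
\<close>

definition success_prob :: "instr list \<Rightarrow> real \<Rightarrow> real list \<Rightarrow> real set \<Rightarrow> ereal \<Rightarrow> real" where
  "success_prob P M xs A B =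
     (SUP k. measure_pmf.prob (run P M xs k) {Halted s t | s t. s \<in> A \<and> ereal (real t) \<le> B})"

definition approximations :: "real \<Rightarrow> real \<Rightarrow> real set" where
  "approximations \<epsilon> S = {s. S / (1 + \<epsilon>) \<le> s \<and> s \<le> (1 + \<epsilon>) * S}"

definition time_bound :: "real \<Rightarrow> real \<Rightarrow> real list \<Rightarrow> ereal" where
  "time_bound C M xs =
     (if sum_list xs = 0 then \<infinity>
      else ereal (C * (M * real (length xs) * log 2 (log 2 (real (length xs))) / sum_list xs)))"

end

theory Submission
  imports Defs
begin

text \<open>
  Draw samples until their sum reaches \<open>K M\<close> with \<open>K = 40 / \<epsilon>\<^sup>2\<close>, and output \<open>K M n / N\<close>, where \<open>N\<close> is the
  number of samples drawn. Since the partial sums are nondecreasing, \<open>N\<close> lies within a factor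
  \<open>1 + \<epsilon>\<close> of \<open>K M n / S\<close>, where \<open>S\<close> is the sum of the list, unless the sum of a fixed number of
  samples is too large (just below this range) or too small (at its upper end); Chebyshev's
  inequality bounds both probabilities. In parallel, the list is summed up item by item. If \<open>n\<close>
  rounds pass without stopping, this exact sum is the output, which covers very small and zero sums.
  The running time is \<open>O (M n / S)\<close>, so the factor \<open>log log n\<close> is not even needed.
\<close>

section \<open>Sums of independent samples\<close>

lemma finite_set_replicate_pmf:
  "finite (set_pmf p) \<Longrightarrow> finite (set_pmf (replicate_pmf m p))"
  using finite_lists_length_eq[of "set_pmf p" m]
  by (simp add: set_replicate_pmf lists_eq_set Collect_conj_eq[symmetric])

lemma expectation_replicate_pmf_Suc:
  fixes h :: "'a list \<Rightarrow> real"
  assumes "finite (set_pmf p)"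
  shows "measure_pmf.expectation (replicate_pmf (Suc m) p) h =
    measure_pmf.expectation p (\<lambda>x. measure_pmf.expectation (replicate_pmf m p) (\<lambda>js. h (x # js)))"
proof -
  have "replicate_pmf (Suc m) p = bind_pmf p (\<lambda>x. map_pmf ((#) x) (replicate_pmf m p))"
    by (simp add: map_pmf_def)
  then show ?thesis
    using finite_set_replicate_pmf[OF assms, of m] assms
    by (simp add: pmf_expectation_bind[of "set_pmf p"] integral_measure_pmf[OF assms])
qed

lemma map_take_replicate_pmf:
  \<comment> \<open>The stopping time is random, but it is controlled by events about prefixes of
    fixed length. This lemma treats such a prefix of the \<open>n\<close> samples as
    \<open>m\<close> independent samples.\<close>
  "m \<le> n \<Longrightarrow> map_pmf (take m) (replicate_pmf n p) = replicate_pmf m p"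
proof (induction n arbitrary: m)
  case (Suc n)
  show ?case
  proof (cases m)
    case (Suc k)
    with Suc.prems Suc.IH[of k] have "map_pmf (take k) (replicate_pmf n p) = replicate_pmf k p"
      by simp
    then show ?thesis
      unfolding Suc replicate_pmf.simps
      by (simp flip: \<open>map_pmf (take k) (replicate_pmf n p) = replicate_pmf k p\<close>)
        (simp add: map_pmf_def bind_assoc_pmf bind_return_pmf)
  qed (simp add: map_pmf_const)
qed simp

text \<open>One induction serves both moments: on splitting off the first sample, the cross term of
  the square vanishes because \<open>g\<close> has mean zero.\<close>

lemma moments_replicate_pmf:
  fixes g :: "'a \<Rightarrow> real"
  assumes fin: "finite (set_pmf p)" and mean: "measure_pmf.expectation p g = 0"
  shows "measure_pmf.expectation (replicate_pmf m p) (\<lambda>js. sum_list (map g js)) = 0"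
    and "measure_pmf.expectation (replicate_pmf m p) (\<lambda>js. (sum_list (map g js))\<^sup>2) =
      real m * measure_pmf.expectation p (\<lambda>x. (g x)\<^sup>2)"
proof (induction m)
  case (Suc m)
  note int = integrable_measure_pmf_finite[OF fin]
    integrable_measure_pmf_finite[OF finite_set_replicate_pmf[OF fin, of m]]
  {
    case 1
    show ?case
      using Suc by (simp add: expectation_replicate_pmf_Suc[OF fin] int mean del: replicate_pmf.simps)
  next
    case 2
    show ?case
      using Suc by (simp add: expectation_replicate_pmf_Suc[OF fin] int mean power2_sum algebra_simps
          del: replicate_pmf.simps)
  }
qed auto

text \<open>From \<open>0 \<le> f \<le> M\<close> follows \<open>f\<^sup>2 \<le> M * f\<close>, so
  one sample has variance at most \<open>M * a\<close>. This is linear in the mean, so a multiple of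
  \<open>M / a\<close> samples gives constant relative error.\<close>

lemma chebyshev_replicate_pmf:
  fixes f :: "'a \<Rightarrow> real"
  assumes fin: "finite (set_pmf p)" and range: "\<And>x. x \<in> set_pmf p \<Longrightarrow> 0 \<le> f x \<and> f x \<le> M"
    and mean: "measure_pmf.expectation p f = a" and "0 < d"
  shows "measure_pmf.prob (replicate_pmf m p) {js. d \<le> \<bar>sum_list (map f js) - real m * a\<bar>}
    \<le> real m * (M * a) / d\<^sup>2"
proof -
  define g where "g = (\<lambda>x. f x - a)"
  note int = integrable_measure_pmf_finite[OF fin]
    integrable_measure_pmf_finite[OF finite_set_replicate_pmf[OF fin, of m]]
  have g0: "measure_pmf.expectation p g = 0"
    by (simp add: g_def int mean)
  note mom = moments_replicate_pmf[OF fin g0, of m]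
  have "measure_pmf.expectation p (\<lambda>x. (g x)\<^sup>2) = measure_pmf.expectation p (\<lambda>x. (f x)\<^sup>2) - a\<^sup>2"
    by (simp add: g_def power2_diff int mean) (simp add: power2_eq_square)
  also have "\<dots> \<le> measure_pmf.expectation p (\<lambda>x. (f x)\<^sup>2)"
    by simp
  also have "\<dots> \<le> measure_pmf.expectation p (\<lambda>x. M * f x)"
    using range by (intro integral_mono_AE int) (auto simp: AE_measure_pmf_iff power2_eq_square intro!: mult_right_mono)
  finally have var: "measure_pmf.expectation p (\<lambda>x. (g x)\<^sup>2) \<le> M * a"
    by (simp add: mean)
  have shift: "sum_list (map g js) = sum_list (map f js) - real m * a"
    if "js \<in> set_pmf (replicate_pmf m p)" for js
    using that by (auto simp: set_replicate_pmf g_def sum_list_subtractf sum_list_triv)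
  have "measure_pmf.prob (replicate_pmf m p) {js. d \<le> \<bar>sum_list (map f js) - real m * a\<bar>} =
      measure_pmf.prob (replicate_pmf m p) {js. d \<le> \<bar>sum_list (map g js)\<bar>}"
    by (intro measure_pmf.finite_measure_eq_AE) (auto simp: AE_measure_pmf_iff shift)
  also have "\<dots> \<le> real m * measure_pmf.expectation p (\<lambda>x. (g x)\<^sup>2) / d\<^sup>2"
    using measure_pmf.Chebyshev_inequality[of "\<lambda>js. sum_list (map g js)" "replicate_pmf m p" d,
        OF _ int(2) \<open>0 < d\<close>] by (simp add: mom)
  also have "\<dots> \<le> real m * (M * a) / d\<^sup>2"
    using var by (intro divide_right_mono mult_left_mono) auto
  finally show ?thesis .
qed

section \<open>The program and its output distribution\<close>

text \<open>Register 2 counts rounds, 3 holds the sum of the samples, 4 the exact sum of the items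
  read so far, 7 the threshold and then the estimate. A continued round costs 7 instructions and the
  jump at address 10; a stopping round costs 7 + 3, and running out of rounds adds one
  \<open>Halt\<close>.\<close>

definition sampler :: "real \<Rightarrow> instr list" where
  "sampler K =
    [Arith 2 Add (Reg 2) (Const 1),
     Sample 5 6,
     Arith 3 Add (Reg 3) (Reg 6),
     Read 6 (Reg 2),
     Arith 4 Add (Reg 4) (Reg 6),
     Arith 7 Mul (Const K) (Reg 1),
     Jump_less (Reg 3) (Reg 7) 10,
     Arith 7 Mul (Reg 7) (Reg 0),
     Arith 7 Div (Reg 7) (Reg 2),
     Halt (Reg 7),
     Jump_less (Reg 2) (Reg 0) 0,
     Halt (Reg 4)]"

text \<open>Unlike \<open>run\<close>, which appends steps at the end, this peels off the first step
  from an arbitrary configuration, so that simplification can execute the program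
  symbolically.\<close>

primrec steps :: "instr list \<Rightarrow> real list \<Rightarrow> nat \<Rightarrow> config \<Rightarrow> config pmf" where
  "steps P xs 0 = return_pmf"
| "steps P xs (Suc k) = (\<lambda>c. bind_pmf (step P xs c) (steps P xs k))"

lemma steps_Suc_right: "steps P xs (Suc k) c = bind_pmf (steps P xs k c) (step P xs)"
proof (induction k arbitrary: c)
  case (Suc k)
  have "steps P xs (Suc (Suc k)) c = bind_pmf (step P xs c) (\<lambda>c. steps P xs (Suc k) c)"
    by simp
  also have "\<dots> = bind_pmf (step P xs c) (\<lambda>c. bind_pmf (steps P xs k c) (step P xs))"
    by (simp only: Suc.IH)
  also have "\<dots> = bind_pmf (steps P xs (Suc k) c) (step P xs)"
    by (simp add: bind_assoc_pmf)
  finally show ?case .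
qed (simp add: bind_return_pmf bind_return_pmf')

lemma run_eq_steps: "run P M xs k = steps P xs k (init M xs)"
  by (induction k) (simp_all add: steps_Suc_right del: steps.simps(2))

lemma steps_Halted [simp]: "steps P xs k (Halted s t) = return_pmf (Halted s t)"
  by (induction k) (simp_all add: bind_return_pmf)

text \<open>The counters \<open>i\<close>, \<open>A\<close>, \<open>t\<close> are the number of completed rounds, the sum of the samples drawn
  so far, and the elapsed time.\<close>

primrec outcome :: "real \<Rightarrow> real \<Rightarrow> real list \<Rightarrow> nat list \<Rightarrow> nat \<Rightarrow> real \<Rightarrow> nat \<Rightarrow> config" where
  "outcome K M xs [] i A t = Halted (sum_list xs) (t + 1)"
| "outcome K M xs (j # js) i A t =
    (if A + item xs j < K * M then outcome K M xs js (Suc i) (A + item xs j) (t + 8)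
     else Halted (K * M * real (length xs) / real (Suc i)) (t + 10))"

lemma steps_sampler_round:
  assumes "\<sigma> 0 = real (length xs)" "\<sigma> 1 = M" "\<sigma> 2 = real i" "\<sigma> 3 = A"
    and "\<sigma> 4 = sum_list (take i xs)" "i < length xs"
  shows "steps (sampler K) xs (7 + k) (Running 0 \<sigma> t) =
    bind_pmf (pmf_of_set {1..length xs}) (\<lambda>j. steps (sampler K) xs k
      (Running (if A + item xs j < K * M then 10 else 7)
        (\<sigma>(2 := real (Suc i), 5 := real j, 6 := item xs j, 3 := A + item xs j, 6 := xs ! i,
           4 := sum_list (take (Suc i) xs), 7 := K * M)) (t + 7)))"
proof -
  \<comment> \<open>The counter is incremented before the read, which matches positions starting
    from 1.\<close>
  have "item xs (addr (1 + real i)) = xs ! i"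
    using assms(6) by (simp add: addr_def item_def nat_add_distrib flip: of_nat_Suc)
  moreover have "sum_list (take i xs) + xs ! i = sum_list (take (Suc i) xs)"
    using assms(6) by (simp add: take_Suc_conv_app_nth)
  moreover have seven: "7 + k = Suc (Suc (Suc (Suc (Suc (Suc (Suc k))))))"
    by simp
  ultimately show ?thesis
    using assms unfolding seven
    by (simp add: sampler_def map_pmf_def bind_assoc_pmf bind_return_pmf add_ac)
      (simp add: eval_nat_numeral cong: if_cong)
qed

text \<open>The machine draws samples on demand, while the right-hand side draws all remaining ones
  in advance; after a stop the surplus is ignored. With \<open>Suc r\<close> rounds left,
  \<open>8 * Suc r + 2\<close> steps reach a halt on every path, and earlier halts are
  absorbing.\<close>

lemma steps_sampler:
  assumes "\<sigma> 0 = real (length xs)" "\<sigma> 1 = M" "\<sigma> 2 = real i" "\<sigma> 3 = A"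
    and "\<sigma> 4 = sum_list (take i xs)" "i + Suc r = length xs"
  shows "steps (sampler K) xs (8 * Suc r + 2) (Running 0 \<sigma> t) =
    map_pmf (\<lambda>js. outcome K M xs js i A t) (replicate_pmf (Suc r) (pmf_of_set {1..length xs}))"
  using assms
proof (induction r arbitrary: i \<sigma> A t)
  case 0
  have "steps (sampler K) xs (8 * Suc 0 + 2) (Running 0 \<sigma> t) = steps (sampler K) xs (7 + 3) (Running 0 \<sigma> t)"
    by simp
  also have "\<dots> = map_pmf (\<lambda>js. outcome K M xs js i A t) (replicate_pmf (Suc 0) (pmf_of_set {1..length xs}))"
    using 0 by (subst steps_sampler_round[where M = M and i = i and A = A])
      (auto simp: sampler_def numeral_eq_Suc map_pmf_def bind_assoc_pmf bind_return_pmf intro!: bind_pmf_cong)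
  finally show ?case .
next
  case (Suc r)
  \<comment> \<open>The budget splits into the straight-line code, one jump, and what the induction
    hypothesis consumes.\<close>
  have "steps (sampler K) xs (8 * Suc (Suc r) + 2) (Running 0 \<sigma> t) =
      steps (sampler K) xs (7 + Suc (8 * Suc r + 2)) (Running 0 \<sigma> t)"
    by simp
  also have "\<dots> = bind_pmf (pmf_of_set {1..length xs}) (\<lambda>j. map_pmf (\<lambda>js. outcome K M xs (j # js) i A t)
      (replicate_pmf (Suc r) (pmf_of_set {1..length xs})))"
  proof (subst steps_sampler_round[where M = M and i = i and A = A], goal_cases)
    case 7
    show ?case
    proof (intro bind_pmf_cong refl, goal_cases)
      case (1 j)
      show ?case
      proof (cases "A + item xs j < K * M")
        case True
        define \<sigma>' where "\<sigma>' = \<sigma>(2 := real (Suc i), 5 := real j, 6 := item xs j,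
          3 := A + item xs j, 6 := xs ! i, 4 := sum_list (take (Suc i) xs), 7 := K * M)"
        have jump: "steps (sampler K) xs (Suc k) (Running 10 \<sigma>' (t + 7)) =
            steps (sampler K) xs k (Running 0 \<sigma>' (t + 8))" for k
          using Suc.prems by (simp add: sampler_def bind_return_pmf \<sigma>'_def add.commute[of 8])
        have IH: "steps (sampler K) xs (8 * Suc r + 2) (Running 0 \<sigma>' (t + 8)) =
            map_pmf (\<lambda>js. outcome K M xs js (Suc i) (A + item xs j) (t + 8))
              (replicate_pmf (Suc r) (pmf_of_set {1..length xs}))"
          by (intro Suc.IH) (use Suc.prems in \<open>simp_all add: \<sigma>'_def\<close>)
        show ?thesis
          unfolding if_P[OF True] \<sigma>'_def[symmetric] jump IH
          by (simp add: True del: replicate_pmf.simps)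
      next
        case False
        then show ?thesis
          using Suc.prems
          by (simp add: sampler_def numeral_eq_Suc map_pmf_const bind_return_pmf map_bind_pmf)
      qed
    qed
  qed (use Suc.prems in simp_all)
  also have "\<dots> = map_pmf (\<lambda>js. outcome K M xs js i A t) (replicate_pmf (Suc (Suc r)) (pmf_of_set {1..length xs}))"
    by (simp add: map_bind_pmf map_pmf_def bind_assoc_pmf bind_return_pmf)
  finally show ?case .
qed

text \<open>Here \<open>k\<close> is the first round in which the threshold is reached;
  \<open>A\<close>, \<open>i\<close> and \<open>t\<close> are general for the sake of the
  induction.\<close>

lemma outcome_cases:
  fixes K M xs
  defines "f \<equiv> \<lambda>js. sum_list (map (item xs) js)"
  assumes "A < K * M"
  obtains (stop) k where "1 \<le> k" "k \<le> length js" "K * M \<le> A + f (take k js)"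
      "A + f (take (k - 1) js) < K * M"
      "outcome K M xs js i A t = Halted (K * M * real (length xs) / real (i + k)) (t + 8 * k + 2)"
    | (full) "A + f js < K * M" "outcome K M xs js i A t = Halted (sum_list xs) (t + 8 * length js + 1)"
proof -
  have "(\<exists>k. 1 \<le> k \<and> k \<le> length js \<and> K * M \<le> A + f (take k js) \<and> A + f (take (k - 1) js) < K * M \<and>
      outcome K M xs js i A t = Halted (K * M * real (length xs) / real (i + k)) (t + 8 * k + 2)) \<or>
    A + f js < K * M \<and> outcome K M xs js i A t = Halted (sum_list xs) (t + 8 * length js + 1)"
    using assms(2)
  proof (induction js arbitrary: i A t)
    case Nil
    then show ?case by (simp add: f_def)
  next
    case (Cons j js)
    show ?case
    proof (cases "A + item xs j < K * M")
      case False
      then show ?thesis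
        using Cons.prems by (intro disjI1 exI[of _ 1]) (simp add: f_def)
    next
      case True
      from Cons.IH[OF True, of "Suc i" "t + 8"] show ?thesis
      proof (elim disjE exE conjE)
        fix k
        assume "1 \<le> k" "k \<le> length js" "K * M \<le> A + item xs j + f (take k js)"
          "A + item xs j + f (take (k - 1) js) < K * M"
          "outcome K M xs js (Suc i) (A + item xs j) (t + 8) =
             Halted (K * M * real (length xs) / real (Suc i + k)) (t + 8 + 8 * k + 2)"
        then show ?thesis
          using True by (intro disjI1 exI[of _ "Suc k"]) (cases k; simp add: f_def add_ac)
      qed (use True in \<open>simp add: f_def add_ac\<close>)
    qed
  qed
  then show thesis using that by blast
qed

lemma run_sampler:
  assumes "xs \<noteq> []"
  shows "run (sampler K) M xs (8 * length xs + 2) =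
    map_pmf (\<lambda>js. outcome K M xs js 0 0 0) (replicate_pmf (length xs) (pmf_of_set {1..length xs}))"
proof -
  obtain r where "length xs = Suc r"
    using assms by (cases xs) auto
  then show ?thesis
    using steps_sampler[of "(\<lambda>_. 0)(0 := real (length xs), 1 := M)" xs M 0 0 r K 0]
    by (simp add: run_eq_steps init_def del: replicate_pmf.simps steps.simps)
qed

section \<open>Accuracy and running time of the sampler\<close>

lemma prob_run_le_success_prob:
  "measure_pmf.prob (run P M xs k) {Halted s t | s t. s \<in> A \<and> ereal (real t) \<le> B} \<le> success_prob P M xs A B"
  unfolding success_prob_def by (rule cSUP_upper) (auto intro!: bdd_aboveI[of _ 1])

lemma item_bounds:
  assumes "set xs \<subseteq> {0..M}" "j \<in> {1..length xs}"
  shows "0 \<le> item xs j \<and> item xs j \<le> M"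
proof -
  have "xs ! (j - 1) \<in> set xs"
    using assms(2) by (intro nth_mem) auto
  with assms show ?thesis
    by (auto simp: item_def)
qed

lemma sum_list_take_mono:
  fixes f :: "'a \<Rightarrow> real"
  assumes "\<And>j. j \<in> set js \<Longrightarrow> 0 \<le> f j" "k \<le> l"
  shows "sum_list (map f (take k js)) \<le> sum_list (map f (take l js))"
proof -
  have "take l js = take k js @ take (l - k) (drop k js)"
    using assms(2) by (metis take_add le_add_diff_inverse)
  then show ?thesis
    using assms(1) by (auto intro!: sum_list_nonneg dest!: in_set_takeD in_set_dropD)
qed

lemma expectation_item:
  assumes "xs \<noteq> []"
  shows "measure_pmf.expectation (pmf_of_set {1..length xs}) (item xs) = sum_list xs / real (length xs)"
proof -
  have "(\<Sum>i = 1..length xs. item xs i) = (\<Sum>i < length xs. item xs (Suc i))"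
    by (simp add: sum.atLeast1_atMost_eq)
  also have "\<dots> = sum_list xs"
    by (auto simp: item_def sum_list_sum_nth atLeast0LessThan intro!: sum.cong)
  finally show ?thesis
    using assms by (subst integral_pmf_of_set) (auto simp: Suc_le_eq)
qed

lemma sampler_success_prob:
  fixes \<epsilon> M :: real and xs :: "real list"
  defines "K \<equiv> 40 / \<epsilon>\<^sup>2" and "S \<equiv> sum_list xs" and "n \<equiv> length xs"
  assumes eps: "0 < \<epsilon>" "\<epsilon> < 1" and M: "0 < M" and ne: "xs \<noteq> []" and range: "set xs \<subseteq> {0..M}"
    and B0: "S = 0 \<Longrightarrow> B = \<infinity>" and B: "S \<noteq> 0 \<Longrightarrow> ereal ((16 * K + 2) * (M * n / S)) \<le> B"
  shows "3 / 4 \<le> success_prob (sampler K) M xs (approximations \<epsilon> S) B"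
proof -
  define H where "H = {Halted s t | s t. s \<in> approximations \<epsilon> S \<and> ereal (real t) \<le> B}"
  define f where "f = (\<lambda>js. sum_list (map (item xs) js))"
  define U where "U = pmf_of_set {1..n}"
  let ?R = "replicate_pmf n U"
  have n: "0 < n" using ne by (simp add: n_def)
  have S: "0 \<le> S" using range by (auto simp: S_def intro!: sum_list_nonneg)
  have K: "0 < K" and Keps: "K * \<epsilon>\<^sup>2 = 40" using eps by (auto simp: K_def)
  have KM: "0 < K * M" using K M by simp
  have setU: "set_pmf U = {1..n}" unfolding U_def using n by (intro set_pmf_of_set) auto
  have finU: "finite (set_pmf U)" by (simp add: setU)
  have nonneg: "0 \<le> item xs j" if "j \<in> {1..n}" for j
    using item_bounds[OF range] that by (auto simp: n_def)
  have R: "set js \<subseteq> {1..n}" "length js = n" if "js \<in> set_pmf ?R" for js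
    using that by (auto simp: set_replicate_pmf setU)
  have mono: "f (take k js) \<le> f (take l js)" if "js \<in> set_pmf ?R" "k \<le> l" for js k l
    unfolding f_def using R(1)[OF that(1)] that(2) by (intro sum_list_take_mono nonneg) auto
  have S_approx: "S \<in> approximations \<epsilon> S"
    using eps S by (simp add: approximations_def field_simps)
  have "3 / 4 \<le> measure_pmf.prob ?R {js. outcome K M xs js 0 0 0 \<in> H}"
  proof (cases "S = 0")
    case True
    \<comment> \<open>With all items zero the positive threshold is never reached, so the exact sum
      is returned.\<close>
    have zero: "item xs = (\<lambda>_. 0)"
    proof
      fix j
      have "\<forall>x\<in>set xs. x = 0"
        using True range unfolding S_def by (subst (asm) sum_list_nonneg_eq_0_iff) auto
      then show "item xs j = 0" by (auto simp: item_def)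
    qed
    have "outcome K M xs js 0 0 0 \<in> H" for js
      using S_approx B0[OF True] KM
      by (cases rule: outcome_cases[OF KM, where js = js and xs = xs and i = 0 and t = 0])
        (auto simp: zero H_def S_def)
    then show ?thesis by simp
  next
    case False
    with S have S0: "0 < S" by simp
    define a where "a = S / n"
    have a: "0 < a" and S_eq: "S = a * n" using S0 n by (auto simp: a_def)
    have mean: "measure_pmf.expectation U (item xs) = a"
      using expectation_item[OF ne] by (simp add: a_def S_def n_def U_def)
    have "S \<le> n * M"
    proof -
      have "sum_list (map (\<lambda>x. x) xs) \<le> sum_list (map (\<lambda>_. M) xs)"
        using range by (intro sum_list_mono) auto
      then show ?thesis by (simp add: sum_list_triv S_def n_def)
    qed
    then have aM: "a \<le> M" using n by (simp add: a_def field_simps)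
    have chebyshev: "measure_pmf.prob ?R {js. d \<le> \<bar>f (take m js) - real m * a\<bar>} \<le> real m * a * M / d\<^sup>2"
      if "0 < d" "m \<le> n" for d m
    proof -
      have "measure_pmf.prob ?R {js. d \<le> \<bar>f (take m js) - real m * a\<bar>} =
          measure_pmf.prob (map_pmf (take m) ?R) {js. d \<le> \<bar>f js - real m * a\<bar>}"
        by (simp add: vimage_def)
      also have "\<dots> \<le> real m * (M * a) / d\<^sup>2"
        unfolding map_take_replicate_pmf[OF that(2)] f_def
        using item_bounds[OF range] that(1)
        by (intro chebyshev_replicate_pmf finU mean) (auto simp: setU n_def)
      finally show ?thesis by (simp add: mult_ac)
    qed

    \<comment> \<open>The estimate \<open>K * M * n / k\<close> is within the factor
      \<open>1 + \<epsilon>\<close> of \<open>S\<close> exactly when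
      \<open>x \<le> k \<le> y\<close>. The cap in \<open>l\<close> keeps the prefix within the
      \<open>n\<close> samples; \<open>u\<close> is uncapped, hence the condition
      \<open>u \<le> n\<close> in \<open>E2\<close>.\<close>
    define x where "x = K * M / ((1 + \<epsilon>) * a)"
    define y where "y = K * M * (1 + \<epsilon>) / a"
    define l where "l = min n (nat \<lfloor>x\<rfloor>)"
    define u where "u = nat \<lfloor>y\<rfloor>"
    have xy: "0 < x" "0 < y" using K M eps a by (auto simp: x_def y_def)
    have l: "l \<le> n" "real l \<le> x" using xy by (auto simp: l_def min_def) linarith
    have u: "real u \<le> y" "y < real u + 1" using xy by (auto simp: u_def)
    have la: "real l * a \<le> K * M / (1 + \<epsilon>)"
      using mult_right_mono[OF l(2), of a] a eps by (simp add: x_def)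
    have ya: "y * a = K * M * (1 + \<epsilon>)" using a by (simp add: y_def)
    \<comment> \<open>Rounding \<open>y\<close> down costs less than one sample mean, and
      \<open>a \<le> M\<close>.\<close>
    have ua: "real u * a \<le> K * M * (1 + \<epsilon>)" "K * M * (1 + \<epsilon>) - M \<le> real u * a"
      using mult_right_mono[OF u(1), of a] mult_strict_right_mono[OF u(2), of a] a aM
      unfolding ya by (auto simp: distrib_right)

    \<comment> \<open>\<open>E1\<close> covers stopping too early, \<open>E2\<close> stopping too
      late.\<close>
    define E1 where "E1 = {js. K * M \<le> f (take l js)}"
    define E2 where "E2 = {js. u \<le> n \<and> f (take u js) < K * M}"
    have E1: "measure_pmf.prob ?R E1 \<le> 1 / 20"
    proof -
      \<comment> \<open>The gap between the threshold and the bound \<open>la\<close> on the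
        mean.\<close>
      define d where "d = K * M * \<epsilon> / (1 + \<epsilon>)"
      have d: "0 < d" using K M eps by (simp add: d_def)
      have "K * M / (1 + \<epsilon>) + d = K * M"
        using eps by (simp add: d_def divide_eq_eq distrib_left flip: add_divide_distrib)
      then have "E1 \<subseteq> {js. d \<le> \<bar>f (take l js) - real l * a\<bar>}" using la by (auto simp: E1_def)
      then have "measure_pmf.prob ?R E1 \<le> real l * a * M / d\<^sup>2"
        by (rule order_trans[OF measure_pmf.finite_measure_mono chebyshev[OF d l(1)]]) simp
      also have "\<dots> \<le> K * M / (1 + \<epsilon>) * M / d\<^sup>2"
        using la M by (intro divide_right_mono mult_right_mono) auto
      also have "\<dots> = (1 + \<epsilon>) / (K * \<epsilon>\<^sup>2)"
      proof -
        have "K * M / e * M / (K * M * \<epsilon> / e)\<^sup>2 = e / (K * \<epsilon>\<^sup>2)" if "0 < e" for e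
          using K M eps that by (simp add: field_simps power2_eq_square)
        then show ?thesis using eps by (simp add: d_def)
      qed
      also have "\<dots> \<le> 1 / 20" using eps by (simp add: Keps)
      finally show ?thesis .
    qed
    have E2: "measure_pmf.prob ?R E2 \<le> 1 / 5"
    proof (cases "u \<le> n")
      case True
      \<comment> \<open>The gap is at least \<open>K * M * \<epsilon> - M\<close>; half of its first
        term absorbs the rounding loss \<open>M\<close>, since
        \<open>K * \<epsilon> \<ge> 2\<close>.\<close>
      define d where "d = K * M * \<epsilon> / 2"
      have d: "0 < d" using K M eps by (simp add: d_def)
      have "K * \<epsilon> * \<epsilon> \<le> K * \<epsilon> * 1" using eps K by (intro mult_left_mono) auto
      then have "2 \<le> K * \<epsilon>" using Keps by (simp add: power2_eq_square)
      then have "2 * M \<le> K * \<epsilon> * M" using M by (intro mult_right_mono) auto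
      then have "K * M + d \<le> real u * a" using ua(2) by (simp add: d_def algebra_simps)
      then have "E2 \<subseteq> {js. d \<le> \<bar>f (take u js) - real u * a\<bar>}" by (auto simp: E2_def)
      then have "measure_pmf.prob ?R E2 \<le> real u * a * M / d\<^sup>2"
        by (rule order_trans[OF measure_pmf.finite_measure_mono chebyshev[OF d True]]) simp
      also have "\<dots> \<le> K * M * (1 + \<epsilon>) * M / d\<^sup>2"
        using ua M by (intro divide_right_mono mult_right_mono) auto
      also have "\<dots> = 4 * (1 + \<epsilon>) / (K * \<epsilon>\<^sup>2)"
        using K M eps by (simp add: d_def field_simps power2_eq_square)
      also have "\<dots> \<le> 1 / 5" using eps by (simp add: Keps)
      finally show ?thesis .
    qed (simp add: E2_def)

    have time: "ereal (real t) \<le> B" if "real t \<le> 8 * y + 2" for t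
    proof -
      \<comment> \<open>\<open>1 + \<epsilon> \<le> 2\<close> bounds \<open>y\<close>, and
        \<open>M / a \<ge> 1\<close> absorbs the additive constant.\<close>
      have "8 * y + 2 \<le> 16 * K * (M / a) + 2 * (M / a)"
      proof (rule add_mono)
        show "8 * y \<le> 16 * K * (M / a)"
          using eps K M a by (simp add: y_def field_simps)
        show "2 \<le> 2 * (M / a)" using aM a by (simp add: field_simps)
      qed
      also have "\<dots> = (16 * K + 2) * (M * n / S)"
        using n a by (simp add: S_eq field_simps)
      finally show ?thesis
        using that B[OF False] by (meson ereal_less_eq(3) order_trans)
    qed

    have good: "outcome K M xs js 0 0 0 \<in> H" if js: "js \<in> set_pmf ?R" "js \<notin> E1" "js \<notin> E2" for js
    proof -
      show ?thesis
      proof (cases rule: outcome_cases[OF KM, where js = js and xs = xs and i = 0 and t = 0,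
          case_names stop full])
        case (stop k)
        have "l < k"
          using mono[OF js(1), of k l] js(2) stop(3) by (fastforce simp: E1_def f_def)
        \<comment> \<open>Since \<open>l < k \<le> n\<close>, the minimum in \<open>l\<close> is the
          rounded \<open>x\<close>, so \<open>x < l + 1 \<le> k\<close>.\<close>
        then have "x \<le> real k"
          using stop(2) R(2)[OF js(1)] by (simp add: l_def min_def split: if_splits) linarith
        then have "K * M \<le> k * ((1 + \<epsilon>) * a)"
          using a eps by (simp add: x_def pos_divide_le_eq)
        from mult_right_mono[OF this, of n] have "K * M * n / k \<le> (1 + \<epsilon>) * S"
          using stop(1) by (simp add: S_eq pos_divide_le_eq mult_ac)
        \<comment> \<open>Otherwise \<open>u \<le> k - 1 < n\<close>, and by monotonicity the first
          \<open>u\<close> samples stay below the threshold, which is \<open>E2\<close>.\<close>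
        moreover have "k \<le> u"
          using mono[OF js(1), of u "k - 1"] js(3) stop(2,4) R(2)[OF js(1)]
          by (fastforce simp: E2_def f_def)
        then have ky: "real k \<le> y" using u(1) by linarith
        then have "k * a \<le> K * M * (1 + \<epsilon>)"
          using a by (simp add: y_def pos_le_divide_eq)
        from mult_right_mono[OF this, of n] have "S / (1 + \<epsilon>) \<le> K * M * n / k"
          using stop(1) eps by (simp add: S_eq pos_divide_le_eq pos_le_divide_eq mult_ac)
        ultimately show ?thesis
          using stop(5) ky time[of "8 * k + 2"] by (auto simp: H_def approximations_def n_def)
      next
        case full
        \<comment> \<open>If \<open>u < n\<close>, the unreached threshold would put
          \<open>js\<close> into \<open>E2\<close>. So even the full scan respects the time
          bound.\<close>
        have "n \<le> u"
          using mono[OF js(1), of u n] js(3) full(1) R(2)[OF js(1)] by (fastforce simp: E2_def f_def)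
        then show ?thesis
          using full(2) R(2)[OF js(1)] S_approx u(1) time[of "8 * n + 1"] by (auto simp: H_def S_def)
      qed
    qed
    \<comment> \<open>Union bound: the failure probability is at most 1/20 + 1/5 = 1/4, which the
      constant 40 in \<open>K\<close> provides.\<close>
    have "1 = measure_pmf.prob ?R (set_pmf ?R)"
      by (simp add: measure_pmf.prob_eq_1 AE_measure_pmf)
    also have "\<dots> \<le> measure_pmf.prob ?R ({js. outcome K M xs js 0 0 0 \<in> H} \<union> E1 \<union> E2)"
      using good by (intro measure_pmf.finite_measure_mono) auto
    also have "\<dots> \<le> measure_pmf.prob ?R {js. outcome K M xs js 0 0 0 \<in> H} +
        measure_pmf.prob ?R E1 + measure_pmf.prob ?R E2"
      by (intro order_trans[OF measure_Un_le] add_right_mono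
          measure_Un_le) auto
    finally show ?thesis using E1 E2 by simp
  qed
  \<comment> \<open>All paths have halted by step \<open>8 * n + 2\<close>; this one index bounds
    the supremum from below.\<close>
  also have "\<dots> = measure_pmf.prob (run (sampler K) M xs (8 * n + 2)) H"
    using run_sampler[OF ne] by (simp add: n_def U_def vimage_def)
  also have "\<dots> \<le> success_prob (sampler K) M xs (approximations \<epsilon> S) B"
    unfolding H_def by (rule prob_run_le_success_prob)
  finally show ?thesis .
qed

theorem theorem5:
  fixes \<epsilon> :: real
  assumes "0 < \<epsilon>" and "\<epsilon> < 1"
  shows "\<exists>(P :: instr list) (C :: real) (n\<^sub>0 :: nat). 0 < C \<and>
    (\<forall>(M :: real) (xs :: real list). 0 < M \<and> xs \<noteq> [] \<and> set xs \<subseteq> {0..M} \<longrightarrow>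
       success_prob P M xs (approximations \<epsilon> (sum_list xs)) \<infinity> \<ge> 3 / 4 \<and>
       (length xs \<ge> n\<^sub>0 \<longrightarrow>
          success_prob P M xs (approximations \<epsilon> (sum_list xs)) (time_bound C M xs) \<ge> 3 / 4))"
proof -
  define K where "K = 40 / \<epsilon>\<^sup>2"
  define C where "C = 16 * K + 2"
  have C: "0 < C" using assms by (simp add: C_def K_def add_pos_pos)
  show ?thesis
  \<comment> \<open>From length 4 on the iterated logarithm is at least 1, so the claimed bound
    dominates \<open>C * M * n / S\<close>.\<close>
  proof (intro exI[of _ "sampler K"] exI[of _ C] exI[of _ 4] conjI allI impI C, goal_cases)
    case (1 M xs)
    then show ?case
      using assms unfolding K_def by (intro sampler_success_prob) auto
  next
    case (2 M xs)
    then have bounds: "0 \<le> sum_list xs" "0 < M" by (auto intro!: sum_list_nonneg)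
    have "2 = log 2 (4::real)" using log_pow_cancel[of 2 2] by simp
    also have "\<dots> \<le> log 2 (length xs)" using 2 by simp
    finally have "1 \<le> log 2 (log 2 (length xs))" by (simp add: le_log_iff)
    then have "M * length xs * 1 \<le> M * length xs * log 2 (log 2 (length xs))"
      using bounds by (intro mult_left_mono) auto
    then have "C * (M * length xs / sum_list xs) \<le>
        C * (M * length xs * log 2 (log 2 (length xs)) / sum_list xs)"
      using C bounds by (intro mult_left_mono divide_right_mono) auto
    then show ?case
      using assms 2 unfolding K_def C_def time_bound_def by (intro sampler_success_prob) auto
  qed
qed

end
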